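(* Let $N=(P,T,F,I,O,\tau)$ be a workflow net, and let $\ell^N_{\mathbb{Q}}$ and $\ell^N_{\mathbb{Z}}$ be the optimal values of $\max\{\vec D\cdot\vec M\mid \vec M=\vec{M_I}+\mathbf N\cdot\vec X,\ \vec M\ge0,\ \vec X\ge0\}$ over rational vectors $\vec M,\vec X$ and over integer vectors $\vec M,\vec X$, respectively. Then: (i) $\ell^N_{\mathbb{Q}}\ge\ell^N_{\mathbb{Z}}\ge\mathrm{CT}(N)$; (ii) if $N$ is a marked graph, then $\ell^N_{\mathbb{Q}}=\ell^N_{\mathbb{Z}}=\mathrm{CT}(N)$; (iii) if $N$ is acyclic, then $\ell^N_{\mathbb{Q}}\ge\ell^N_{\mathbb{Z}}=\mathrm{CT}(N)$.
   Context: A workflow net: a Petri net $(P,T,F)$ with input/output places $I,O$, $\bullet I=\emptyset=O\bullet$, every node on a path from some input to some output place, and durations $\tau\colon P\to\mathbb{N}$; $M_I$ puts one token on each place of $I$ and none elsewhere. Reachability uses the usual firing rule. The incidence matrix $\mathbf N$ is the $|P|\times|T|$ matrix with $\mathbf N(p,t)=1$ if $p\in t\bullet\setminus\bullet t$, $-1$ if $p\in\bullet t\setminus t\bullet$, and $0$ otherwise. $\vec D\in\{0,1\}^P$ has $\vec D(p)=1$ iff $\tau(p)>0$. $\mathrm{CT}(N)=\max\{\sum_{p:\tau(p)>0}M(p)\mid M\text{ reachable from }M_I\}$. $N$ is a marked graph if $|\bullet p|\le1$ and $|p\bullet|\le1$ for every place; acyclic if the reflexive-transitive closure of $F$ is a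 partial order.
   Formalization: In (ii), the equality of the integer optimum with CT(N) is stated only for marked graphs in which every transition is enabled at some reachable marking; without this it fails, e.g. for one transition t with inputs {0,1}, outputs {1,2}, I={0}, O={2}, and positive duration only at place 2. *)

theory Defs
  imports Complex_Main "HOL-Library.Extended_Real"
begin

record ('p, 't) net =
  places :: "'p set"
  trans :: "'t set"
  flow :: "('p + 't) rel"
  inputs :: "'p set"
  outputs :: "'p set"
  dur :: "'p \<Rightarrow> nat"

definition nodes :: "('p, 't) net \<Rightarrow> ('p + 't) set" where
  "nodes N = Inl ` places N \<union> Inr ` trans N"

definition preset :: "('p, 't) net \<Rightarrow> 'p + 't \<Rightarrow> ('p + 't) set" where
  "preset N x = {y. (y, x) \<in> flow N}"

definition postset :: "('p, 't) net \<Rightarrow> 'p + 't \<Rightarrow> ('p + 't) set" where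
  "postset N x = {y. (x, y) \<in> flow N}"

definition petri_net :: "('p, 't) net \<Rightarrow> bool" where
  "petri_net N \<longleftrightarrow> finite (places N) \<and> finite (trans N) \<and>
     flow N \<subseteq> (Inl ` places N) \<times> (Inr ` trans N) \<union> (Inr ` trans N) \<times> (Inl ` places N)"

definition workflow_net :: "('p, 't) net \<Rightarrow> bool" where
  "workflow_net N \<longleftrightarrow> petri_net N \<and>
     inputs N \<subseteq> places N \<and> outputs N \<subseteq> places N \<and>
     (\<forall>i\<in>inputs N. preset N (Inl i) = {}) \<and>
     (\<forall>j\<in>outputs N. postset N (Inl j) = {}) \<and>
     (\<forall>x\<in>nodes N. \<exists>i\<in>inputs N. \<exists>j\<in>outputs N.
        (Inl i, x) \<in> (flow N)\<^sup>* \<and> (x, Inl j) \<in> (flow N)\<^sup>*)"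

definition marked_graph :: "('p, 't) net \<Rightarrow> bool" where
  "marked_graph N \<longleftrightarrow> (\<forall>p\<in>places N. card (preset N (Inl p)) \<le> 1 \<and> card (postset N (Inl p)) \<le> 1)"

definition acyclic_net :: "('p, 't) net \<Rightarrow> bool" where
  "acyclic_net N \<longleftrightarrow> partial_order_on (nodes N) (Restr ((flow N)\<^sup>*) (nodes N))"

definition initial_marking :: "('p, 't) net \<Rightarrow> 'p \<Rightarrow> nat" where
  "initial_marking N p = (if p \<in> inputs N then 1 else 0)"

definition enabled :: "('p, 't) net \<Rightarrow> ('p \<Rightarrow> nat) \<Rightarrow> 't \<Rightarrow> bool" where
  "enabled N M t \<longleftrightarrow> t \<in> trans N \<and> (\<forall>p. Inl p \<in> preset N (Inr t) \<longrightarrow> M p \<ge> 1)"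

definition fire :: "('p, 't) net \<Rightarrow> 't \<Rightarrow> ('p \<Rightarrow> nat) \<Rightarrow> 'p \<Rightarrow> nat" where
  "fire N t M p = M p - of_bool (Inl p \<in> preset N (Inr t)) + of_bool (Inl p \<in> postset N (Inr t))"

definition step :: "('p, 't) net \<Rightarrow> ('p \<Rightarrow> nat) \<Rightarrow> ('p \<Rightarrow> nat) \<Rightarrow> bool" where
  "step N M M' \<longleftrightarrow> (\<exists>t. enabled N M t \<and> M' = fire N t M)"

definition reachable :: "('p, 't) net \<Rightarrow> ('p \<Rightarrow> nat) \<Rightarrow> bool" where
  "reachable N M \<longleftrightarrow> (step N)\<^sup>*\<^sup>* (initial_marking N) M"

definition no_dead_transitions :: "('p, 't) net \<Rightarrow> bool" where
  "no_dead_transitions N \<longleftrightarrow> (\<forall>t\<in>trans N. \<exists>M. reachable N M \<and> enabled N M t)"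

definition incidence :: "('p, 't) net \<Rightarrow> 'p \<Rightarrow> 't \<Rightarrow> int" where
  "incidence N p t =
     (if Inl p \<in> postset N (Inr t) - preset N (Inr t) then 1
      else if Inl p \<in> preset N (Inr t) - postset N (Inr t) then - 1
      else 0)"

definition busy :: "('p, 't) net \<Rightarrow> 'p \<Rightarrow> nat" where
  "busy N p = (if dur N p > 0 then 1 else 0)"

text \<open>
  Maxima are taken as suprema in the extended reals: a workflow net may be unbounded, and then
  the concurrency threshold and the optimal values below are \<open>\<infinity>\<close>.
\<close>

definition CT :: "('p, 't) net \<Rightarrow> ereal" where
  "CT N = Sup {ereal (real (\<Sum>p | p \<in> places N \<and> dur N p > 0. M p)) | M. reachable N M}"

text \<open>
  Vectors indexed by places and transitions are functions of which only the values on
  \<^term>\<open>places N\<close> and \<^term>\<open>trans N\<close> matter. Taking the coefficient type to be \<^typ>\<open>rat\<close> or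
  \<^typ>\<open>int\<close> gives the two optimization problems.
\<close>

definition feasible ::
  "('p, 't) net \<Rightarrow> ('p \<Rightarrow> 'k::linordered_idom) \<Rightarrow> ('t \<Rightarrow> 'k) \<Rightarrow> bool" where
  "feasible N M X \<longleftrightarrow>
     (\<forall>p\<in>places N. M p = of_nat (initial_marking N p) + (\<Sum>t\<in>trans N. of_int (incidence N p t) * X t)) \<and>
     (\<forall>p\<in>places N. M p \<ge> 0) \<and> (\<forall>t\<in>trans N. X t \<ge> 0)"

definition objective :: "('p, 't) net \<Rightarrow> ('p \<Rightarrow> 'k::linordered_idom) \<Rightarrow> 'k" where
  "objective N M = (\<Sum>p\<in>places N. of_nat (busy N p) * M p)"

definition opt_rat :: "('p, 't) net \<Rightarrow> ereal" where
  "opt_rat N = Sup {ereal (real_of_rat (objective N M)) | (M :: 'p \<Rightarrow> rat) (X :: 't \<Rightarrow> rat). feasible N M X}"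

definition opt_int :: "('p, 't) net \<Rightarrow> ereal" where
  "opt_int N = Sup {ereal (real_of_int (objective N M)) | (M :: 'p \<Rightarrow> int) (X :: 't \<Rightarrow> int). feasible N M X}"

text \<open>
  For a marked graph, \<^const>\<open>opt_int\<close> and \<^const>\<open>CT\<close> can differ when the net has dead
  transitions. Input places have no producers, so they lie on no cycle. Hence in a marked graph
  every cycle is unmarked initially and stays unmarked, and its transitions are dead, but the state
  equation may still use them. In the witness below, one transition consumes from places 0 and 1
  and produces on places 1 and 2. Absence of dead transitions, which is part of soundness of a
  workflow net, rules this out.
\<close>

lemma marked_graph_dead_transition_gap:
  "\<exists>N :: (nat, unit) net. workflow_net N \<and> marked_graph N \<and> CT N < opt_int N"
proof -
  define N :: "(nat, unit) net" where
    "N = \<lparr>places = {0, 1, 2}, trans = {()},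
       flow = {(Inl 0, Inr ()), (Inl 1, Inr ()), (Inr (), Inl 1), (Inr (), Inl 2)},
       inputs = {0}, outputs = {2}, dur = (\<lambda>p. if p = 2 then 1 else 0)\<rparr>"
  let ?t = "Inr () :: nat + unit"
  have F: "(Inl 0, ?t) \<in> flow N" "(Inl 1, ?t) \<in> flow N" "(?t, Inl 1) \<in> flow N" "(?t, Inl 2) \<in> flow N"
    by (auto simp: N_def)
  have R0: "(Inl 0, x) \<in> (flow N)\<^sup>*" and R1: "(x, Inl 2) \<in> (flow N)\<^sup>*" if "x \<in> nodes N" for x
  proof -
    have "x \<in> {Inl 0, Inl 1, Inl 2, ?t}" using that by (auto simp: nodes_def N_def)
    then show "(Inl 0, x) \<in> (flow N)\<^sup>*" "(x, Inl 2) \<in> (flow N)\<^sup>*"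
      using F by (auto intro: converse_rtrancl_into_rtrancl)
  qed
  have W: "workflow_net N"
    unfolding workflow_net_def
  proof (intro conjI ballI)
    fix x assume "x \<in> nodes N"
    then show "\<exists>i\<in>inputs N. \<exists>j\<in>outputs N. (Inl i, x) \<in> (flow N)\<^sup>* \<and> (x, Inl j) \<in> (flow N)\<^sup>*"
      using R0 R1 by (auto simp: N_def)
  qed (auto simp: petri_net_def preset_def postset_def N_def)
  have pre: "preset N (Inl p) = (if p \<in> {1, 2} then {?t} else {})"
    and post: "postset N (Inl p) = (if p \<in> {0, 1} then {?t} else {})" for p
    by (auto simp: preset_def postset_def N_def)
  have G: "marked_graph N"
    unfolding marked_graph_def pre post by auto
  have "\<not> step N (initial_marking N) M" for M
    using F by (auto simp: step_def enabled_def preset_def initial_marking_def N_def)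
  then have init: "M = initial_marking N" if "reachable N M" for M
    using that unfolding reachable_def by (metis converse_rtranclpE)
  have "(\<Sum>p | p \<in> places N \<and> dur N p > 0. M p) = 0" if "reachable N M" for M
    unfolding init[OF that] by (auto simp: initial_marking_def N_def)
  then have "{ereal (real (\<Sum>p | p \<in> places N \<and> dur N p > 0. M p)) | M. reachable N M} \<subseteq> {0}"
    by force
  then have "CT N \<le> 0"
    unfolding CT_def by (intro Sup_least) auto
  also have "(0::ereal) < 1" by simp
  also have "1 \<le> opt_int N"
    unfolding opt_int_def
  proof (rule Sup_upper, intro CollectI exI conjI)
    show "feasible N (\<lambda>p. if p = 2 then 1 else 0) (\<lambda>_. 1 :: int)"
      by (auto simp: feasible_def incidence_def preset_def postset_def initial_marking_def N_def)
    show "1 = ereal (real_of_int (objective N (\<lambda>p. if p = 2 then 1 else 0)))"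
      by (simp add: objective_def busy_def N_def one_ereal_def)
  qed
  finally show ?thesis using W G by blast
qed

end

theory Submission
  imports Defs
begin

text \<open>
  A firing sequence yields a solution of the state equation, and an integer solution is a rational
  one. For an acyclic net, an integer solution \<open>X\<close> is realised by repeatedly firing a transition of
  its support that is minimal for the flow relation: no other transition of the support feeds its
  input places, so they carry enough tokens. In a marked graph without dead transitions there are
  no cycles, because places on cycles are empty initially and only transitions on cycles could put
  tokens there. Finally, a rational solution \<open>X = a / q\<close> of a marked graph can be shifted and rounded
  down to \<open>\<lfloor>(a + k) / q\<rfloor>\<close>, which respects the difference constraints; by Hermite's identity the
  average over \<open>k < q\<close> is \<open>X\<close>, so for some \<open>k\<close> the objective does not decrease.
\<close>

section \<open>Incidence matrix, firing and the state equation\<close>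

text \<open>On a self-loop both indicators are 1 and cancel. This form lets producers and consumers
  of a place be treated separately.\<close>

lemma incidence_eq:
  "incidence N p t = of_bool ((Inr t, Inl p) \<in> flow N) - of_bool ((Inl p, Inr t) \<in> flow N)"
  by (auto simp: incidence_def preset_def postset_def)

text \<open>Enabledness makes the truncated subtraction in \<open>fire\<close> exact, so over the
  integers a firing adds one column of the incidence matrix.\<close>

lemma fire_eq:
  assumes "enabled N M t"
  shows "int (fire N t M p) = int (M p) + incidence N p t"
  using assms by (auto simp: fire_def enabled_def incidence_eq preset_def postset_def of_nat_diff)

lemma sum_fun_upd_Suc:
  fixes c :: "'t \<Rightarrow> int"
  assumes "finite T" "t \<in> T"
  shows "(\<Sum>s\<in>T. c s * int ((X(t := Suc (X t))) s)) = c t + (\<Sum>s\<in>T. c s * int (X s))"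
  using assms by (simp add: sum.remove[of T t] algebra_simps)

text \<open>The witness \<open>X\<close> counts how often each transition occurs in the firing
  sequence.\<close>

lemma state_equation:
  assumes "finite (trans N)" "reachable N M"
  shows "\<exists>X :: 't \<Rightarrow> nat. \<forall>p. int (M p) =
    int (initial_marking N p) + (\<Sum>t\<in>trans (N :: ('p, 't) net). incidence N p t * int (X t))"
  using assms(2) unfolding reachable_def
proof (induction rule: rtranclp_induct)
  case base
  show ?case by (rule exI[of _ "\<lambda>_. 0"]) simp
next
  case (step M M')
  obtain X :: "'t \<Rightarrow> nat" where X: "\<And>p. int (M p) =
      int (initial_marking N p) + (\<Sum>t\<in>trans N. incidence N p t * int (X t))"
    using step.IH by blast
  obtain t where t: "enabled N M t" "M' = fire N t M"
    using step.hyps(2) by (auto simp: step_def)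
  have "t \<in> trans N" using t(1) by (simp add: enabled_def)
  then show ?case
    using t sum_fun_upd_Suc[OF assms(1), of t _ X]
    by (intro exI[of _ "X(t := Suc (X t))"]) (simp add: fire_eq X del: fun_upd_apply)
qed

section \<open>Comparing the rational optimum, the integer optimum and the threshold\<close>

lemma feasible_of_int:
  assumes "feasible N M (X :: 't \<Rightarrow> int)"
  shows "feasible N (\<lambda>p. of_int (M p) :: rat) (\<lambda>t. of_int (X t))"
proof -
  have "rat_of_int (M p) = of_nat (initial_marking N p) +
      (\<Sum>t\<in>trans N. of_int (incidence N p t) * of_int (X t))" if "p \<in> places N" for p
  proof -
    have "M p = int (initial_marking N p) + (\<Sum>t\<in>trans N. incidence N p t * X t)"
      using assms that by (simp add: feasible_def)
    then show ?thesis by simp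
  qed
  moreover have "rat_of_int (M p) \<ge> 0" if "p \<in> places N" for p
    using assms that by (metis feasible_def of_int_0_le_iff)
  moreover have "rat_of_int (X t) \<ge> 0" if "t \<in> trans N" for t
    using assms that by (simp add: feasible_def)
  ultimately show ?thesis unfolding feasible_def by blast
qed

lemma opt_int_le_opt_rat: "opt_int N \<le> opt_rat N"
  unfolding opt_int_def
proof (rule Sup_least, clarify)
  fix M :: "'a \<Rightarrow> int" and X :: "'b \<Rightarrow> int"
  assume "feasible N M X"
  then have "feasible N (\<lambda>p. of_int (M p) :: rat) (\<lambda>t. of_int (X t))" by (rule feasible_of_int)
  moreover have "real_of_int (objective N M) = real_of_rat (objective N (\<lambda>p. of_int (M p)))"
    by (simp add: objective_def of_rat_sum of_rat_mult)
  ultimately show "ereal (real_of_int (objective N M)) \<le> opt_rat N"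
    unfolding opt_rat_def by (intro Sup_upper CollectI) metis
qed

lemma objective_of_nat:
  assumes "finite (places N)"
  shows "objective N (\<lambda>p. int (M p)) = int (\<Sum>p | p \<in> places N \<and> dur N p > 0. M p)"
  unfolding objective_def sum.inter_filter[OF assms] of_nat_sum
  by (intro sum.cong) (auto simp: busy_def)

lemma CT_le_opt_int:
  assumes "petri_net N"
  shows "CT N \<le> opt_int N"
  unfolding CT_def
proof (rule Sup_least, clarify)
  fix M :: "'a \<Rightarrow> nat"
  assume M: "reachable N M"
  have fin: "finite (trans N)" "finite (places N)" using assms by (auto simp: petri_net_def)
  obtain X :: "'b \<Rightarrow> nat" where X: "\<forall>p. int (M p) =
      int (initial_marking N p) + (\<Sum>t\<in>trans N. incidence N p t * int (X t))"
    using state_equation[OF fin(1) M] ..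
  have "feasible N (\<lambda>p. int (M p)) (\<lambda>t. int (X t))"
    unfolding feasible_def of_int_eq_id id_apply by (simp flip: X[rule_format])
  moreover have "real (\<Sum>p | p \<in> places N \<and> dur N p > 0. M p)
      = real_of_int (objective N (\<lambda>p. int (M p)))"
    using fin by (simp add: objective_of_nat)
  ultimately show "ereal (real (\<Sum>p | p \<in> places N \<and> dur N p > 0. M p)) \<le> opt_int N"
    unfolding opt_int_def by (intro Sup_upper CollectI) metis
qed

section \<open>Acyclic nets: realising integer solutions by firing sequences\<close>

text \<open>Induction on the number of firings still owed. The start marking is arbitrary because
  each firing changes it, while the target marking stays fixed.\<close>

lemma acyclic_realizable:
  fixes N :: "('p, 't) net" and X :: "'t \<Rightarrow> nat"
  assumes net: "petri_net N" and acyc: "acyclic (flow N)"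
    and "\<forall>p\<in>places N. 0 \<le> int (M0 p) + (\<Sum>t\<in>trans N. incidence N p t * int (X t))"
  shows "\<exists>M. (step N)\<^sup>*\<^sup>* M0 M \<and>
    (\<forall>p\<in>places N. int (M p) = int (M0 p) + (\<Sum>t\<in>trans N. incidence N p t * int (X t)))"
  using assms(3)
proof (induction "\<Sum>t\<in>trans N. X t" arbitrary: M0 X)
  case 0
  then have "X t = 0" if "t \<in> trans N" for t
    using net that by (auto simp: petri_net_def)
  then show ?case by (intro exI[of _ M0]) auto
next
  case (Suc n)
  have fin: "finite (trans N)" "finite (places N)"
    and sub: "flow N \<subseteq> Inl ` places N \<times> Inr ` trans N \<union> Inr ` trans N \<times> Inl ` places N"
    using net by (auto simp: petri_net_def)
  have "finite (flow N)"
    using fin by (intro finite_subset[OF sub]) auto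
  \<comment> \<open>The transitive closure is needed because two transitions are linked only through
    a place, hence by at least two edges.\<close>
  then have "wf ((flow N)\<^sup>+)"
    using acyc by (intro wf_trancl finite_acyclic_wf)
  moreover obtain t0 where "t0 \<in> trans N" "X t0 > 0"
    using Suc.hyps(2) by (metis gr0I nat.distinct(1) sum.neutral)
  then have "Inr t0 \<in> Inr ` {t \<in> trans N. X t > 0}" by blast
  ultimately obtain z where "z \<in> Inr ` {t \<in> trans N. X t > 0}"
    and z: "\<And>y. (y, z) \<in> (flow N)\<^sup>+ \<Longrightarrow> y \<notin> Inr ` {t \<in> trans N. X t > 0}"
    by (rule wfE_min) blast
  then obtain t where t: "t \<in> trans N" "X t > 0" "z = Inr t" by blast
  have "M0 p \<ge> 1" if p: "(Inl p, Inr t) \<in> flow N" for p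
  proof -
    have "p \<in> places N" using p sub by auto
    \<comment> \<open>A transition of the support producing on \<open>p\<close> would precede
      \<open>t\<close> via \<open>p\<close>, against minimality. So every summand only
      consumes.\<close>
    have le: "incidence N p s * int (X s) \<le> 0" if "s \<in> trans N" for s
    proof (cases "X s = 0")
      case False
      then have "(Inr s, Inr t) \<notin> (flow N)\<^sup>+" using z[of "Inr s"] t(3) that by auto
      then have "(Inr s, Inl p) \<notin> flow N" using p by (meson r_into_trancl' trancl.trancl_into_trancl)
      then show ?thesis by (simp add: incidence_eq)
    qed simp
    \<comment> \<open>There is no self-loop at \<open>p\<close>, so \<open>t\<close> itself
      contributes at most -1. The nonnegative target then forces a token on \<open>p\<close> at the
      start.\<close>
    have "(Inr t, Inl p) \<notin> flow N"
      using p acyc by (meson acyclic_def r_into_trancl' trancl.trancl_into_trancl)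
    then have "incidence N p t * int (X t) \<le> - 1" using p t(2) by (simp add: incidence_eq)
    moreover have "(\<Sum>s\<in>trans N - {t}. incidence N p s * int (X s)) \<le> 0"
      by (intro sum_nonpos le) auto
    ultimately have "(\<Sum>s\<in>trans N. incidence N p s * int (X s)) \<le> - 1"
      using fin t(1) by (simp add: sum.remove[of _ t])
    then show ?thesis using Suc.prems \<open>p \<in> places N\<close> by fastforce
  qed
  then have en: "enabled N M0 t" using t by (auto simp: enabled_def preset_def)
  define Y where "Y = X(t := X t - 1)"
  have X: "X = Y(t := Suc (Y t))" using t by (auto simp: Y_def)
  have "(\<Sum>s\<in>trans N. X s) = Suc (\<Sum>s\<in>trans N. Y s)"
    unfolding X using fin t(1) by (simp add: sum.remove[of _ t])
  then have n: "n = (\<Sum>s\<in>trans N. Y s)" using Suc.hyps(2) by simp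
  \<comment> \<open>One column moves from the sum into the marking, so the nonnegativity hypothesis
    carries over to the smaller instance.\<close>
  have eq: "int (fire N t M0 p) + (\<Sum>s\<in>trans N. incidence N p s * int (Y s))
      = int (M0 p) + (\<Sum>s\<in>trans N. incidence N p s * int (X s))" for p
    unfolding X sum_fun_upd_Suc[OF fin(1) t(1)] fire_eq[OF en] by simp
  obtain M where "(step N)\<^sup>*\<^sup>* (fire N t M0) M"
    "\<forall>p\<in>places N. int (M p) = int (M0 p) + (\<Sum>s\<in>trans N. incidence N p s * int (X s))"
    using Suc.hyps(1)[OF n, of "fire N t M0"] Suc.prems unfolding eq by blast
  moreover have "step N M0 (fire N t M0)" using en by (auto simp: step_def)
  ultimately show ?case by (meson converse_rtranclp_into_rtranclp)
qed

lemma acyclic_opt_int_le_CT: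
  assumes net: "petri_net N" and acyc: "acyclic (flow N)"
  shows "opt_int N \<le> CT N"
  unfolding opt_int_def
proof (rule Sup_least, clarify)
  fix M :: "'a \<Rightarrow> int" and X :: "'b \<Rightarrow> int"
  assume f: "feasible N M X"
  \<comment> \<open>\<open>nat\<close> loses nothing here: feasibility gives
    \<open>X t \<ge> 0\<close> on all transitions that are summed.\<close>
  have X: "(\<Sum>t\<in>trans N. incidence N p t * int (nat (X t)))
      = (\<Sum>t\<in>trans N. incidence N p t * X t)" for p
    using f by (intro sum.cong) (auto simp: feasible_def)
  have M: "M p = int (initial_marking N p) + (\<Sum>t\<in>trans N. incidence N p t * int (nat (X t)))"
    if "p \<in> places N" for p
    using f that unfolding X by (simp add: feasible_def)
  have "M p \<ge> 0" if "p \<in> places N" for p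
    using f that unfolding feasible_def by blast
  then have "\<forall>p\<in>places N.
      0 \<le> int (initial_marking N p) + (\<Sum>t\<in>trans N. incidence N p t * int (nat (X t)))"
    by (simp flip: M del: int_nat_eq)
  from acyclic_realizable[OF assms this] obtain M'
    where M': "(step N)\<^sup>*\<^sup>* (initial_marking N) M'" "\<forall>p\<in>places N. int (M' p) = M p"
    by (auto simp flip: M simp del: int_nat_eq)
  have "objective N M = objective N (\<lambda>p. int (M' p))"
    using M'(2) by (simp add: objective_def)
  then have "real_of_int (objective N M) = real (\<Sum>p | p \<in> places N \<and> dur N p > 0. M' p)"
    using net by (simp add: objective_of_nat petri_net_def)
  then show "ereal (real_of_int (objective N M)) \<le> CT N"
    using M'(1) unfolding CT_def reachable_def by (intro Sup_upper CollectI) metis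
qed

text \<open>The flow relation is bipartite, so an edge joins distinct nodes; an edge on a cycle
  therefore violates antisymmetry.\<close>

lemma acyclic_net_acyclic_flow:
  assumes net: "petri_net N" and "acyclic_net N"
  shows "acyclic (flow N)"
  unfolding acyclic_def
proof (intro allI notI)
  fix x assume "(x, x) \<in> (flow N)\<^sup>+"
  then obtain y where y: "(x, y) \<in> flow N" "(y, x) \<in> (flow N)\<^sup>*"
    by (meson tranclD)
  then have "x \<noteq> y" "x \<in> nodes N" "y \<in> nodes N"
    using net by (auto simp: petri_net_def nodes_def)
  then show False
    using assms(2) y unfolding acyclic_net_def partial_order_on_def antisym_def by blast
qed

section \<open>Marked graphs without dead transitions are acyclic\<close>

text \<open>Emptiness of all cycle places is an invariant: the only producer of such a place lies on
  the cycle too, and must consume from another cycle place, which is empty.\<close>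

lemma marked_graph_cycle_places_empty:
  assumes net: "workflow_net N" and mg: "marked_graph N"
    and "reachable N M" "(Inl p, Inl p) \<in> (flow N)\<^sup>+"
  shows "M p = 0"
  using assms(3,4) unfolding reachable_def
proof (induction arbitrary: p rule: rtranclp_induct)
  case base
  then have "preset N (Inl p) \<noteq> {}" by (auto simp: preset_def dest: tranclD2)
  then show ?case using net by (auto simp: workflow_net_def initial_marking_def)
next
  case (step M M')
  have sub: "flow N \<subseteq> Inl ` places N \<times> Inr ` trans N \<union> Inr ` trans N \<times> Inl ` places N"
    and fin: "finite (trans N)"
    using net by (auto simp: workflow_net_def petri_net_def)
  obtain t where t: "enabled N M t" "M' = fire N t M"
    using step.hyps(2) by (auto simp: step_def)
  show ?case
  proof (cases "(Inr t, Inl p) \<in> flow N")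
    case False
    then show ?thesis using step.IH[OF step.prems] t by (simp add: fire_def postset_def)
  next
    case True
    obtain y where y: "(Inl p, y) \<in> (flow N)\<^sup>*" "(y, Inl p) \<in> flow N"
      using step.prems by (meson tranclD2)
    have "p \<in> places N" using True sub by auto
    then have "card (preset N (Inl p)) \<le> 1" using mg by (simp add: marked_graph_def)
    moreover have "finite (preset N (Inl p))"
      using sub fin by (intro finite_subset[of "preset N (Inl p)" "Inr ` trans N"]) (auto simp: preset_def)
    \<comment> \<open>The predecessor of \<open>p\<close> on the cycle and the fired transition both
      produce on \<open>p\<close>, which has a single producer.\<close>
    ultimately have "y = Inr t"
      using y(2) True by (auto simp: preset_def card_le_Suc0_iff_eq)
    then have "(Inr t, Inr t) \<in> (flow N)\<^sup>+" using y(1) True by (meson rtrancl_into_trancl2)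
    \<comment> \<open>One edge further back lies a cycle place that feeds \<open>t\<close>; its
      emptiness contradicts that \<open>t\<close> was enabled.\<close>
    then obtain x where x: "(Inr t, x) \<in> (flow N)\<^sup>*" "(x, Inr t) \<in> flow N"
      by (meson tranclD2)
    then obtain p' where p': "x = Inl p'" using sub by auto
    then have "M p' = 0" using step.IH x by (meson rtrancl_into_trancl2)
    then show ?thesis using t(1) x p' by (fastforce simp: enabled_def preset_def)
  qed
qed

lemma live_marked_graph_acyclic:
  assumes net: "workflow_net N" and mg: "marked_graph N" and nd: "no_dead_transitions N"
  shows "acyclic (flow N)"
  unfolding acyclic_def
proof (intro allI notI)
  have sub: "flow N \<subseteq> Inl ` places N \<times> Inr ` trans N \<union> Inr ` trans N \<times> Inl ` places N"
    using net by (auto simp: workflow_net_def petri_net_def)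
  have *: False if p: "(Inl p, Inl p) \<in> (flow N)\<^sup>+" for p
  proof -
    obtain y where y: "(Inl p, y) \<in> flow N" using p by (meson tranclD)
    then obtain t where t: "y = Inr t" "t \<in> trans N" using sub by auto
    then obtain M where "reachable N M" "enabled N M t"
      using nd by (auto simp: no_dead_transitions_def)
    then show False
      using marked_graph_cycle_places_empty[OF net mg _ p] y t
      by (fastforce simp: enabled_def preset_def)
  qed
  fix x assume x: "(x, x) \<in> (flow N)\<^sup>+"
  \<comment> \<open>Of \<open>x\<close> and its successor \<open>y\<close>, one is a place, and both
    lie on the cycle.\<close>
  then obtain y where y: "(x, y) \<in> flow N" "(y, x) \<in> (flow N)\<^sup>*" by (meson tranclD)
  then have "(y, y) \<in> (flow N)\<^sup>+" by (meson rtrancl_into_trancl1)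
  then show False using x y(1) sub * by blast
qed

section \<open>Marked graphs: rounding rational solutions\<close>

text \<open>Passing from \<open>a\<close> to \<open>Suc a\<close> shifts the window of summands by
  one: \<open>a div q\<close> leaves and \<open>(a + q) div q\<close>, larger by 1, enters.\<close>

lemma hermite_div:
  assumes "q > 0"
  shows "(\<Sum>k<q. (a + k) div q) = (a::nat)"
proof (induction a)
  case 0
  show ?case by simp
next
  case (Suc a)
  obtain r where q: "q = Suc r" using assms gr0_conv_Suc by blast
  have "(\<Sum>k<q. (Suc a + k) div q) + a div q = (\<Sum>k<Suc q. (a + k) div q)"
    by (simp add: sum.lessThan_Suc_shift del: sum.lessThan_Suc)
  also have "\<dots> = a + (a + q) div q" using Suc.IH by simp
  finally show ?case using assms by simp
qed

lemma common_denominator: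
  fixes X :: "'t \<Rightarrow> rat"
  assumes "finite T" "\<forall>t\<in>T. X t \<ge> 0"
  shows "\<exists>q a. q > 0 \<and> (\<forall>t\<in>T. X t * of_nat q = of_nat (a t))"
  using assms
proof (induction rule: finite_induct)
  case empty
  show ?case by auto
next
  case (insert t T)
  then obtain q a where q: "q > 0" "\<forall>s\<in>T. X s * of_nat q = of_nat (a s)" by auto
  obtain m n where mn: "quotient_of (X t) = (m, n)" by fastforce
  have n: "n > 0" using mn by (rule quotient_of_denom_pos)
  have X: "X t = of_int m / of_int n" using mn by (rule quotient_of_div)
  have "0 \<le> X t" using insert.prems by simp
  then have "m \<ge> 0" using n unfolding X by (simp add: zero_le_divide_iff)
  define m' n' where "m' = nat m" and "n' = nat n"
  have m': "rat_of_int m = of_nat m'" and n': "rat_of_int n = of_nat n'" and "n' > 0"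
    using \<open>m \<ge> 0\<close> n by (auto simp: m'_def n'_def)
  \<comment> \<open>The new common denominator is the product of the old one and that of
    \<open>X t\<close>; numerators are rescaled accordingly.\<close>
  have "X s * of_nat (q * n') = of_nat (if s = t then m' * q else a s * n')"
    if "s \<in> insert t T" for s
  proof (cases "s = t")
    case True
    then show ?thesis using \<open>n' > 0\<close> by (simp add: X m' n')
  next
    case False
    then have "X s * of_nat q = of_nat (a s)" using that q(2) by simp
    with False show ?thesis by (simp add: mult.assoc[symmetric])
  qed
  moreover have "q * n' > 0" using q(1) \<open>n' > 0\<close> by simp
  ultimately show ?case by (intro exI[of _ "q * n'"] exI[of _ "\<lambda>s. if s = t then m' * q else a s * n'"]) blast
qed

lemma sum_incidence:
  fixes X :: "'t \<Rightarrow> 'k::linordered_idom"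
  assumes "finite (trans N)"
  shows "(\<Sum>t\<in>trans N. of_int (incidence N p t) * X t)
    = (\<Sum>t | t \<in> trans N \<and> (Inr t, Inl p) \<in> flow N. X t)
      - (\<Sum>t | t \<in> trans N \<and> (Inl p, Inr t) \<in> flow N. X t)"
  unfolding sum.inter_filter[OF assms] sum_subtractf[symmetric]
  by (intro sum.cong) (auto simp: incidence_eq)

text \<open>With producer \<open>s\<close> and consumer \<open>s'\<close> the constraint is
  \<open>a s' \<le> q * m + a s\<close>. Adding \<open>k\<close> on both sides and applying the
  monotone \<open>div q\<close> preserves it, as \<open>q * m\<close> comes out as
  \<open>m\<close>.\<close>

lemma marked_graph_rounding:
  assumes net: "petri_net N" and mg: "marked_graph N" and p: "p \<in> places N"
    and k: "k < q"
    and nonneg: "0 \<le> int q * int m + (\<Sum>t\<in>trans N. incidence N p t * int (a t))"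
  shows "0 \<le> int m + (\<Sum>t\<in>trans N. incidence N p t * int ((a t + k) div q))"
proof -
  have fin: "finite (trans N)"
    and sub: "flow N \<subseteq> Inl ` places N \<times> Inr ` trans N \<union> Inr ` trans N \<times> Inl ` places N"
    using net by (auto simp: petri_net_def)
  let ?A = "{t. t \<in> trans N \<and> (Inr t, Inl p) \<in> flow N}"
  let ?B = "{t. t \<in> trans N \<and> (Inl p, Inr t) \<in> flow N}"
  have "preset N (Inl p) = Inr ` ?A" "postset N (Inl p) = Inr ` ?B"
    using sub by (auto simp: preset_def postset_def)
  then have "card ?A \<le> 1" "card ?B \<le> 1"
    using mg p by (auto simp: marked_graph_def card_image)
  moreover have "finite ?A" "finite ?B" using fin by auto
  moreover have "S = {} \<or> (\<exists>s. S = {s})" if "card S \<le> 1" "finite S" for S :: "'b set"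
    using that card_1_singletonE[of S] by (cases "card S = 0") auto
  ultimately have "?A = {} \<or> (\<exists>s. ?A = {s})" "?B = {} \<or> (\<exists>s. ?B = {s})"
    by presburger+
  moreover have S: "(\<Sum>t\<in>trans N. incidence N p t * f t) = sum f ?A - sum f ?B" for f :: "'b \<Rightarrow> int"
    using sum_incidence[OF fin, of p f] by simp
  ultimately consider "?B = {}" | s where "?A = {}" "?B = {s}" | s s' where "?A = {s}" "?B = {s'}" by blast
  then show ?thesis
  proof cases
    case 1
    show ?thesis unfolding S 1 by (simp add: sum_nonneg)
  next
    case 2
    have "int (a s) \<le> int (q * m)" using nonneg unfolding S 2 by simp
    then have "a s \<le> q * m" by (simp only: of_nat_le_iff)
    \<comment> \<open>Without a producer the shift is not matched on the other side;
      \<open>k < q\<close> keeps the quotient from exceeding \<open>m\<close>.\<close>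
    then have "a s + k < Suc m * q" using k by (simp add: mult.commute)
    then have "(a s + k) div q < Suc m" by (rule less_mult_imp_div_less)
    then have "int ((a s + k) div q) \<le> int m" by linarith
    then show ?thesis unfolding S 2 by simp
  next
    case 3
    have "int (a s') \<le> int (q * m + a s)" using nonneg unfolding S 3 by simp
    then have "a s' \<le> q * m + a s" by (simp only: of_nat_le_iff)
    then have "(a s' + k) div q \<le> (a s + k + m * q) div q"
      by (intro div_le_mono) (simp add: mult.commute)
    then have "(a s' + k) div q \<le> m + (a s + k) div q" using k by simp
    then have "int ((a s' + k) div q) \<le> int m + int ((a s + k) div q)" by linarith
    then show ?thesis unfolding S 3 by simp
  qed
qed

lemma marked_graph_opt_rat_le_opt_int:
  assumes net: "petri_net N" and mg: "marked_graph N"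
  shows "opt_rat N \<le> opt_int N"
  unfolding opt_rat_def
proof (rule Sup_least, clarify)
  fix M :: "'a \<Rightarrow> rat" and X :: "'b \<Rightarrow> rat"
  assume f: "feasible N M X"
  have fin: "finite (trans N)" using net by (auto simp: petri_net_def)
  obtain q a where q: "q > 0" and a: "\<forall>t\<in>trans N. X t * of_nat q = of_nat (a t)"
    using common_denominator[OF fin, of X] f by (auto simp: feasible_def)
  define Y where "Y k t = int ((a t + k) div q)" for k t
  \<comment> \<open>The marking is defined by the state equation, so only its nonnegativity is left
    to check.\<close>
  define L where "L k p = int (initial_marking N p) + (\<Sum>t\<in>trans N. incidence N p t * Y k t)" for k p
  have qM: "of_nat q * M p
      = of_int (int q * int (initial_marking N p) + (\<Sum>t\<in>trans N. incidence N p t * int (a t)))"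
    if "p \<in> places N" for p
  proof -
    have "of_nat q * M p = of_nat q * of_nat (initial_marking N p)
        + (\<Sum>t\<in>trans N. of_int (incidence N p t) * (X t * of_nat q))"
      using f that by (simp add: feasible_def algebra_simps sum_distrib_left)
    also have "(\<Sum>t\<in>trans N. of_int (incidence N p t) * (X t * of_nat q))
        = (\<Sum>t\<in>trans N. of_int (incidence N p t) * of_nat (a t))"
      using a by (intro sum.cong) auto
    finally show ?thesis by simp
  qed
  have nonneg: "0 \<le> L k p" if "k < q" "p \<in> places N" for k p
  proof -
    have "0 \<le> M p" using f that by (metis feasible_def)
    then have "0 \<le> of_nat q * M p" by simp
    then show ?thesis
      unfolding L_def Y_def qM[OF that(2)] of_int_0_le_iff
      by (intro marked_graph_rounding[OF net mg that(2,1)])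
  qed
  have feas: "feasible N (L k) (Y k)" if "k < q" for k
    using nonneg[OF that] by (auto simp: feasible_def L_def Y_def)
  \<comment> \<open>The average of the \<open>Y k\<close> over \<open>k < q\<close> is
    \<open>X\<close> on the transitions, so by linearity the average of the \<open>L k\<close> is
    \<open>M\<close> on the places.\<close>
  have "(\<Sum>k<q. Y k t) = int (a t)" for t
    unfolding Y_def using hermite_div[OF q] by (metis of_nat_sum)
  then have "(\<Sum>k<q. L k p)
      = int q * int (initial_marking N p) + (\<Sum>t\<in>trans N. incidence N p t * int (a t))" for p
    by (simp add: L_def sum.distrib sum.swap[of _ "trans N"] sum_distrib_left[symmetric])
  then have avg: "(\<Sum>k<q. of_int (L k p)) = of_nat q * M p" if "p \<in> places N" for p
    using qM[OF that] by (metis of_int_sum)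
  have "(\<Sum>k<q. of_int (objective N (L k))) = (\<Sum>p\<in>places N. of_nat (busy N p) * (\<Sum>k<q. of_int (L k p)))"
    by (simp add: objective_def sum.swap[of _ "{..<q}"] sum_distrib_left)
  also have "\<dots> = of_nat q * objective N M"
    by (simp add: objective_def sum_distrib_left avg algebra_simps)
  finally have total: "(\<Sum>k<q. of_int (objective N (L k))) = of_nat q * objective N M" .
  have "\<exists>k<q. objective N M \<le> of_int (objective N (L k))"
  proof (rule ccontr)
    assume "\<not> ?thesis"
    then have "(\<Sum>k<q. of_int (objective N (L k))) < (\<Sum>k<q. objective N M)"
      using q by (intro sum_strict_mono) auto
    then show False using total by simp
  qed
  then obtain k where k: "k < q" "objective N M \<le> of_int (objective N (L k))" by blast
  then have "real_of_rat (objective N M) \<le> real_of_int (objective N (L k))"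
    by (metis of_rat_less_eq of_rat_of_int_eq)
  moreover have "ereal (real_of_int (objective N (L k))) \<le> opt_int N"
    unfolding opt_int_def using feas[OF k(1)] by (intro Sup_upper CollectI) blast
  ultimately show "ereal (real_of_rat (objective N M)) \<le> opt_int N"
    by (meson ereal_less_eq(3) order_trans)
qed

theorem theorem2:
  fixes N :: "('p, 't) net"
  assumes "workflow_net N"
  shows "(opt_rat N \<ge> opt_int N \<and> opt_int N \<ge> CT N) \<and>
         (marked_graph N \<longrightarrow>
            opt_rat N = opt_int N \<and> (no_dead_transitions N \<longrightarrow> opt_int N = CT N)) \<and>
         (acyclic_net N \<longrightarrow> opt_rat N \<ge> opt_int N \<and> opt_int N = CT N)"
proof -
  have net: "petri_net N" using assms by (simp add: workflow_net_def)
  \<comment> \<open>For marked graphs, rounding equates the two optima, and absence of dead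
    transitions reduces equality with \<open>CT\<close> to the acyclic case.
    \<open>marked_graph_dead_transition_gap\<close> shows why that assumption appears.\<close>
  show ?thesis
    using opt_int_le_opt_rat[of N] CT_le_opt_int[OF net] acyclic_opt_int_le_CT[OF net]
      marked_graph_opt_rat_le_opt_int[OF net] acyclic_net_acyclic_flow[OF net]
      live_marked_graph_acyclic[OF assms]
    by (auto intro: antisym)
qed

end
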